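(* Let $n$ be an odd positive integer and let $a$ be an integer with $1\leq a<n$ that is relatively prime to $n$. Then $P(n)\geq \#\mathcal{P}_{a,n}$, where $P(n)$ is the maximal period of Ducci sequences of integer $n$-tuples and $\mathcal{P}_{a,n}$ is the set of partitions of integers $\leq t-1$ into distinct parts from $\mathcal{S}_{a,n}$, with $t$ the multiplicative order of $2$ modulo $n$.
   Context: Ducci sequences: for a positive integer $n$, a Ducci sequence is a sequence of integer $n$-tuples obtained by iterating the map $D:\mathbb{Z}^n\to\mathbb{Z}^n$, $D(a_1,a_2,\ldots,a_n)=(|a_1-a_2|,|a_2-a_3|,\ldots,|a_n-a_1|)$. Every such sequence is eventually periodic, and $P(n)$ denotes the largest (eventual, minimal) period among all Ducci sequences of integer $n$-tuples. For odd $n$, $t$ denotes the multiplicative order of $2$ modulo $n$. For an integer $a$ with $1\leq a<n$ and $\gcd(a,n)=1$, define \[ \mathcal{S}_{a,n}=\{j\in\mathbb{Z}_{>0} : 1\leq j\leq n,\ \gcd(j,n)=1,\ \exists e_j\in\mathbb{Z}_{\geq 0} \text{ with } j\equiv a2^{e_j} \bmod n\}, \] i.e. the set of representatives in $[1,n]$ of the coset $a\langle 2\rangle\subseteq(\mathbb{Z}/n\mathbb{Z})^*$; it has cardinality $t$. Define \[ \mathcal{P}_{a,n}=\Big\{(u_j)_{j\in\mathcal{S}_{a,n}}\in\{0,1\}^{t} : \sum_{j\in\mathcal{S}_{a,n}}u_j\, j\leq t-1\Big\}. \] (The all-zero tuple is included.) *)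

theory Defs
  imports "HOL-Number_Theory.Number_Theory" "HOL-Library.FuncSet"
begin

text \<open>Integer n-tuples are lists of length n; the paper's index i in 1..n is list position i - 1.\<close>

definition ducci :: "int list \<Rightarrow> int list" where
  "ducci xs = map (\<lambda>i. \<bar>xs ! i - xs ! (Suc i mod length xs)\<bar>) [0..<length xs]"

definition eventual_period_of :: "(nat \<Rightarrow> 'a) \<Rightarrow> nat \<Rightarrow> bool" where
  "eventual_period_of s p \<longleftrightarrow> 0 < p \<and> (\<exists>N. \<forall>k\<ge>N. s (k + p) = s k)"

text \<open>Minimal eventual period; only meaningful for eventually periodic sequences.\<close>

definition eventual_period :: "(nat \<Rightarrow> 'a) \<Rightarrow> nat" where
  "eventual_period s = (LEAST p. eventual_period_of s p)"

text \<open>\<open>Max\<close> is meaningful here because, for fixed n > 0, every Ducci sequence is eventually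
  periodic and only finitely many periods occur: a Ducci sequence eventually takes its values in
  tuples with entries in {0, c} for some c, on which the map is determined by the case c = 1.\<close>

definition ducci_max_period :: "nat \<Rightarrow> nat" where
  "ducci_max_period n =
     Max {eventual_period (\<lambda>k. (ducci ^^ k) xs) | xs. length xs = n}"

definition coset_reps :: "nat \<Rightarrow> nat \<Rightarrow> nat set" where
  "coset_reps a n =
     {j. 1 \<le> j \<and> j \<le> n \<and> coprime j n \<and> (\<exists>e. [j = a * 2 ^ e] (mod n))}"

text \<open>A tuple indexed by \<open>coset_reps a n\<close> is an extensional function on that set. For odd n the
  order \<open>ord n 2\<close> is positive, so the subtraction on \<open>nat\<close> does not truncate.\<close>

definition distinct_partitions :: "nat \<Rightarrow> nat \<Rightarrow> (nat \<Rightarrow> nat) set" where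
  "distinct_partitions a n =
     {u \<in> coset_reps a n \<rightarrow>\<^sub>E {0, 1}. (\<Sum>j\<in>coset_reps a n. u j * j) \<le> ord n 2 - 1}"

end

theory Submission
  imports Defs "HOL-Algebra.Algebraic_Closure_Type" "HOL-Library.Z2"
begin

text \<open>
  Modulo 2 the Ducci map is linear: reading a tuple as the polynomial with these coefficients,
  it multiplies by \<open>1 + x\<^sup>-\<^sup>1\<close> in \<open>\<bbbF>\<^sub>2[x]/(x\<^sup>n - 1)\<close>. Evaluating at \<open>x = z\<^sup>-\<^sup>1\<close> for an \<open>n\<close>-th root
  of unity \<open>z \<noteq> 1\<close> in an algebraic closure of \<open>\<bbbF>\<^sub>2\<close>, every Ducci step becomes multiplication by
  \<open>1 + z\<close>. A tuple with value 1 therefore has an eventual period \<open>p\<close> with \<open>(1 + z)\<^sup>p = 1\<close>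
  (\<open>unit_tuple_period\<close>), and it remains to show that \<open>1 + z\<close> has many different powers, for
  the choice \<open>z = w\<^sup>a\<close> with \<open>w\<close> of order exactly \<open>n\<close>.

  By Frobenius, \<open>(1 + w\<^sup>a)\<close> raised to \<open>2\<^sup>e\<close> is \<open>1 + w\<^sup>j\<close> whenever \<open>j \<equiv> a 2\<^sup>e\<close> modulo \<open>n\<close>; so for
  every set \<open>U\<close> of coset representatives the product of the \<open>1 + w\<^sup>j\<close> over \<open>j \<in> U\<close> is a power of
  \<open>1 + z\<close>. It is the value at \<open>w\<close> of the polynomial \<open>\<Prod>j\<in>U. 1 + X\<^sup>j\<close>, of degree \<open>\<Sum>U\<close>. Different
  sets give different polynomials (\<open>partition_poly_inj\<close>), and polynomials over \<open>\<bbbF>\<^sub>2\<close> of degree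
  less than \<open>t = ord n 2\<close> are determined by their value at \<open>w\<close>, because \<open>w\<close> has the \<open>t\<close> distinct
  conjugates given by repeated squaring (\<open>order_two_le_degree\<close>). Hence the sets with
  \<open>\<Sum>U \<le> t - 1\<close> yield pairwise different powers of \<open>1 + z\<close>, of which there are at most \<open>p\<close>.

  The maximal period is a \<open>Max\<close>, which bounds its elements only for a finite set; so one also
  needs a bound on all periods. It comes from the classical fact that a Ducci sequence ends up with
  entries in \<open>{0, M}\<close>, whence its period is at most \<open>2\<^sup>n\<close> (\<open>ducci_eventual_period\<close>).
\<close>

section \<open>Finitely many periods\<close>

text \<open>The local step of the next lemma. Since \<open>f\<close> stays in the interval from 0 to \<open>M\<close>, a difference
  \<open>M\<close> is only possible between 0 and \<open>M\<close>; from there, differences 0 or \<open>M\<close> spread membership in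
  \<open>{0, M}\<close> to both sides.\<close>

lemma difference_propagates_extremes:
  fixes f :: "nat \<Rightarrow> int"
  assumes bounds: "\<And>j. 0 \<le> f j \<and> f j \<le> M"
    and diffs: "\<And>j. j \<le> m \<Longrightarrow> \<bar>f j - f (Suc j)\<bar> \<in> {0, M}"
    and top: "j0 \<le> m" "\<bar>f j0 - f (Suc j0)\<bar> = M"
  shows "(\<forall>j\<le>Suc m. f j \<in> {0, M}) \<and> (\<exists>j\<le>Suc m. f j = M)"
proof -
  have j0: "f j0 \<in> {0, M}" and ex: "f j0 = M \<or> f (Suc j0) = M"
    using bounds[of j0] bounds[of "Suc j0"] top(2) by auto
  have step: "f j \<in> {0, M} \<longleftrightarrow> f (Suc j) \<in> {0, M}" if "j \<le> m" for j
    using bounds[of j] bounds[of "Suc j"] diffs[OF that] by auto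
  have from0: "f j \<in> {0, M} \<longleftrightarrow> f 0 \<in> {0, M}" if "j \<le> Suc m" for j
    using that
  proof (induction j)
    case (Suc j)
    then show ?case using step[of j] by simp
  qed simp
  have "\<forall>j\<le>Suc m. f j \<in> {0, M}"
    using j0 from0 le_SucI[OF top(1)] by blast
  moreover have "\<exists>j\<le>Suc m. f j = M"
    using ex
  proof
    assume "f j0 = M"
    then show ?thesis using top(1) by (intro exI[of _ j0]) simp
  next
    assume "f (Suc j0) = M"
    then show ?thesis using top(1) by (intro exI[of _ "Suc j0"]) simp
  qed
  ultimately show ?thesis ..
qed

text \<open>An entry equal to the global bound \<open>M\<close> constrains its past: going back one step, the window of
  entries known to be extremal grows by one. The second conjunct, that \<open>M\<close> itself occurs in the
  window, keeps the induction going. For a sequence of period \<open>n\<close>, the window covers everything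
  after \<open>n\<close> steps.\<close>

lemma maximum_forces_extremes:
  fixes g :: "nat \<Rightarrow> nat \<Rightarrow> int"
  assumes rec: "\<And>k j. g (Suc k) j = \<bar>g k j - g k (Suc j)\<bar>"
    and bounds: "\<And>k j. 0 \<le> g k j \<and> g k j \<le> M"
    and top: "g (k + m) i = M"
  shows "(\<forall>j\<le>m. g k (i + j) \<in> {0, M}) \<and> (\<exists>j\<le>m. g k (i + j) = M)"
  using top
proof (induction m arbitrary: k)
  case (Suc m)
  then have IH: "(\<forall>j\<le>m. g (Suc k) (i + j) \<in> {0, M}) \<and> (\<exists>j\<le>m. g (Suc k) (i + j) = M)"
    by simp
  then obtain j0 where j0: "j0 \<le> m" "g (Suc k) (i + j0) = M" by blast
  show ?case
  proof (rule difference_propagates_extremes[OF _ _ j0(1)])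
    show "0 \<le> g k (i + j) \<and> g k (i + j) \<le> M" for j
      by (rule bounds)
    show "\<bar>g k (i + j) - g k (i + Suc j)\<bar> \<in> {0, M}" if "j \<le> m" for j
      using IH that unfolding add_Suc_right rec[symmetric] by blast
    show "\<bar>g k (i + j0) - g k (i + Suc j0)\<bar> = M"
      using j0(2) rec[of k "i + j0"] by simp
  qed
qed simp

text \<open>Reading a tuple as a periodic sequence removes the wrap-around from the Ducci map.\<close>

definition cyc :: "'a list \<Rightarrow> nat \<Rightarrow> 'a" where
  "cyc xs j = xs ! (j mod length xs)"

lemma length_ducci [simp]: "length (ducci xs) = length xs"
  by (simp add: ducci_def)

lemma length_funpow_ducci [simp]: "length ((ducci ^^ k) xs) = length xs"
  by (induction k) simp_all

lemma cyc_ducci: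
  assumes "xs \<noteq> []"
  shows "cyc (ducci xs) j = \<bar>cyc xs j - cyc xs (Suc j)\<bar>"
proof -
  have "j mod length xs < length xs" using assms by simp
  then show ?thesis
    by (simp add: cyc_def ducci_def mod_Suc_eq)
qed

lemma cyc_in_set: "xs \<noteq> [] \<Longrightarrow> cyc xs j \<in> set xs"
  by (simp add: cyc_def)

lemma set_conv_cyc: "xs \<noteq> [] \<Longrightarrow> set xs = range (cyc xs)"
  by (auto simp: cyc_in_set) (metis cyc_def in_set_conv_nth mod_less rangeI)

text \<open>The least upper bound \<open>M\<close> that the entries ever satisfy is attained at every later time, by
  minimality; in particular it is attained \<open>length xs\<close> steps after any given time, and this forces
  all entries at that time to be extremal.\<close>

lemma ducci_orbit_eventually_two_valued:
  assumes "xs \<noteq> []"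
  shows "\<exists>M K. \<forall>k\<ge>K. set ((ducci ^^ k) xs) \<subseteq> {0, M}"
proof -
  let ?g = "\<lambda>k. cyc ((ducci ^^ k) xs)"
  have ne: "(ducci ^^ k) xs \<noteq> []" for k
    using assms by (metis length_0_conv length_funpow_ducci)
  have rec: "?g (Suc k) j = \<bar>?g k j - ?g k (Suc j)\<bar>" for k j
    using cyc_ducci[OF ne] by simp
  define bounded where "bounded = (\<lambda>k M. \<forall>j. 0 \<le> ?g k j \<and> ?g k j \<le> int M)"
  have "finite (range (?g 1))"
    using set_conv_cyc[OF ne[of 1]] by (metis List.finite_set)
  then obtain B where B: "\<forall>j. ?g 1 j \<le> B"
    by (metis UNIV_I finite_imageI Max_ge image_eqI)
  \<comment> \<open>The initial tuple may have negative entries; nonnegativity starts after one step.\<close>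
  have "bounded 1 (nat B)"
    unfolding bounded_def
  proof (intro allI conjI)
    fix j
    show "0 \<le> ?g 1 j" using rec[of 0 j] by simp
    show "?g 1 j \<le> int (nat B)" using spec[OF B, of j] by linarith
  qed
  then have ex: "\<exists>M k. bounded k M" by blast
  define M where "M = (LEAST M. \<exists>k. bounded k M)"
  obtain K where K: "bounded K M"
    using LeastI_ex[OF ex] unfolding M_def by blast
  have later: "bounded (K + d) M" for d
  proof (induction d)
    case (Suc d)
    show ?case
      unfolding bounded_def
    proof
      fix j
      have "0 \<le> ?g (K + d) j \<and> ?g (K + d) j \<le> int M"
        "0 \<le> ?g (K + d) (Suc j) \<and> ?g (K + d) (Suc j) \<le> int M"
        using Suc unfolding bounded_def by blast+
      then show "0 \<le> ?g (K + Suc d) j \<and> ?g (K + Suc d) j \<le> int M"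
        using rec[of "K + d" j] by auto
    qed
  qed (use K in simp)
  have attained: "\<exists>i. ?g (K + d) i = int M" for d
  proof (rule ccontr)
    assume none: "\<nexists>i. ?g (K + d) i = int M"
    have b: "0 \<le> ?g (K + d) j \<and> ?g (K + d) j < int M" for j
      using later[of d] none unfolding bounded_def by (metis less_le)
    then have "M > 0" by (metis of_nat_0_less_iff order_le_less_trans)
    then have "bounded (K + d) (M - 1)"
      using b unfolding bounded_def by (auto simp: of_nat_diff)
    then have "M \<le> M - 1"
      unfolding M_def by (intro Least_le) blast
    then show False using \<open>M > 0\<close> by simp
  qed
  have "set ((ducci ^^ k) xs) \<subseteq> {0, int M}" if k: "k \<ge> K" for k
  proof -
    obtain d where d: "k = K + d" using le_Suc_ex[OF k] by (elim exE)
    let ?n = "length xs"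
    obtain i where i: "?g (K + (d + ?n)) i = int M" using attained[of "d + ?n"] by (elim exE)
    have "(\<forall>j\<le>?n. ?g (K + d) (i + j) \<in> {0, int M}) \<and> (\<exists>j\<le>?n. ?g (K + d) (i + j) = int M)"
    proof (rule maximum_forces_extremes[where g = "\<lambda>d. ?g (K + d)"])
      show "?g (K + Suc d) j = \<bar>?g (K + d) j - ?g (K + d) (Suc j)\<bar>" for d j
        using rec[of "K + d"] by simp
      show "0 \<le> ?g (K + d) j \<and> ?g (K + d) j \<le> int M" for d j
        using later[of d] unfolding bounded_def by blast
    qed (rule i)
    then have all: "\<forall>j\<le>?n. ?g (K + d) (i + j) \<in> {0, int M}" ..
    show ?thesis
    proof
      fix v assume "v \<in> set ((ducci ^^ k) xs)"
      then obtain l where l: "l < ?n" "v = (ducci ^^ k) xs ! l"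
        by (auto simp: in_set_conv_nth)
      \<comment> \<open>The offset that leads from \<open>i\<close> to a position congruent to \<open>l\<close>.\<close>
      define j where "j = (if i mod ?n \<le> l then l - i mod ?n else l + ?n - i mod ?n)"
      have "i mod ?n < ?n" using assms by simp
      then have "i mod ?n + j = l \<or> i mod ?n + j = l + ?n"
        unfolding j_def by auto
      then have "(i mod ?n + j) mod ?n = l"
        using l(1) by auto
      then have "(i + j) mod ?n = l"
        by (simp add: mod_add_left_eq)
      then have "v = ?g (K + d) (i + j)"
        using l d by (simp add: cyc_def)
      moreover have "j \<le> ?n" unfolding j_def using l(1) by auto
      ultimately show "v \<in> {0, int M}" using all by blast
    qed
  qed
  then show ?thesis by blast
qed

lemma eventual_period_of_bounded:
  assumes rec: "\<And>k. s (Suc k) = f (s k)"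
    and fin: "finite A" and A: "\<And>k. k \<ge> K \<Longrightarrow> s k \<in> A"
  shows "\<exists>p\<le>card A. eventual_period_of s p"
proof -
  have "(\<lambda>i. s (K + i)) ` {..card A} \<subseteq> A" using A by auto
  then have "\<not> inj_on (\<lambda>i. s (K + i)) {..card A}"
    by (metis card_atMost card_inj_on_le fin lessI not_le)
  then obtain i j where ij: "i < j" "j \<le> card A" "s (K + i) = s (K + j)"
    unfolding inj_on_def by (metis atMost_iff linorder_neqE_nat)
  have shift: "s (m + d) = (f ^^ d) (s m)" for m d
    by (induction d) (simp_all add: rec)
  have "s (k + (j - i)) = s k" if "k \<ge> K + i" for k
  proof -
    obtain d where d: "k = K + i + d" using \<open>k \<ge> K + i\<close> le_Suc_ex by blast
    have "s (k + (j - i)) = s (K + j + d)" using d ij(1) by (simp add: algebra_simps)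
    also have "\<dots> = s k" unfolding d shift[of "K + j"] shift[of "K + i"] ij(3) ..
    finally show ?thesis .
  qed
  then have "eventual_period_of s (j - i)"
    unfolding eventual_period_of_def using ij(1) by auto
  then show ?thesis using ij(2) by (meson diff_le_self order_trans)
qed

text \<open>The \<open>LEAST\<close> in \<open>eventual_period\<close> is meaningful for Ducci sequences, and the period bound is
  the number of tuples over \<open>{0, M}\<close>, which is independent of \<open>M\<close>.\<close>

lemma ducci_eventual_period:
  assumes "xs \<noteq> []"
  defines "s \<equiv> \<lambda>k. (ducci ^^ k) xs"
  shows "eventual_period_of s (eventual_period s)"
    and "eventual_period s \<le> 2 ^ length xs"
proof -
  obtain M K where MK: "\<forall>k\<ge>K. set (s k) \<subseteq> {0, M}"
    using ducci_orbit_eventually_two_valued[OF assms(1)] unfolding s_def by blast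
  let ?A = "{ys. set ys \<subseteq> {0, M} \<and> length ys = length xs}"
  have "\<exists>p\<le>card ?A. eventual_period_of s p"
    by (rule eventual_period_of_bounded[where f = ducci and K = K])
       (use MK in \<open>auto simp: s_def finite_lists_length_eq\<close>)
  then obtain p where p: "p \<le> card ?A" "eventual_period_of s p" by blast
  have "card ?A \<le> 2 ^ length xs"
    by (subst card_lists_length_eq) (auto intro!: power_mono simp: card_insert_if)
  with p show "eventual_period s \<le> 2 ^ length xs"
    unfolding eventual_period_def by (meson Least_le order_trans)
  show "eventual_period_of s (eventual_period s)"
    unfolding eventual_period_def by (rule LeastI[of "eventual_period_of s", OF p(2)])
qed

lemma eventual_period_le_ducci_max_period:
  assumes "n > 0" and "length xs = n"
  shows "eventual_period (\<lambda>k. (ducci ^^ k) xs) \<le> ducci_max_period n"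
  unfolding ducci_max_period_def
proof (rule Max_ge)
  have "{eventual_period (\<lambda>k. (ducci ^^ k) xs) |xs. length xs = n} \<subseteq> {..2 ^ n}"
    using ducci_eventual_period(2) assms(1) by force
  then show "finite {eventual_period (\<lambda>k. (ducci ^^ k) xs) |xs. length xs = n}"
    by (rule finite_subset) simp
qed (use assms(2) in blast)

section \<open>The Ducci map as multiplication in characteristic two\<close>

lemma diff_eq_add_char2:
  assumes "(2::'a::comm_ring_1) = 0"
  shows "c - d = c + (d::'a)"
proof -
  have "d + d = 0"
    using assms by (metis mult_2 mult_zero_left)
  then show ?thesis by (simp add: diff_eq_eq add.assoc)
qed

lemma of_int_abs_diff_char2:
  assumes "(2::'a::comm_ring_1) = 0"
  shows "(of_int \<bar>x - y\<bar> :: 'a) = of_int x + of_int y"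
  by (simp add: abs_if diff_eq_add_char2[OF assms] add.commute)

text \<open>The value of the tuple as a polynomial at \<open>z\<^sup>-\<^sup>1\<close>. The inverse appears because the Ducci map
  pairs each entry with its successor: shifting the tuple to the left multiplies the value by \<open>z\<close>.\<close>

definition cyclic_eval :: "'a::field \<Rightarrow> int list \<Rightarrow> 'a" where
  "cyclic_eval z xs = (\<Sum>i<length xs. of_int (cyc xs i) * inverse z ^ i)"

lemma cyclic_eval_ducci:
  fixes z :: "'a::field"
  assumes char2: "(2::'a) = 0" and "xs \<noteq> []" and z: "z ^ length xs = 1"
  shows "cyclic_eval z (ducci xs) = (1 + z) * cyclic_eval z xs"
proof -
  let ?n = "length xs"
  define h where "h = (\<lambda>i. (of_int (cyc xs i) :: 'a) * inverse z ^ i)"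
  have z0: "z \<noteq> 0" using z \<open>xs \<noteq> []\<close> by (metis length_0_conv power_0_left zero_neq_one)
  have per: "h ?n = h 0"
    using z by (simp add: h_def cyc_def power_inverse)
  have "(\<Sum>i<?n. h (Suc i)) + h 0 = (\<Sum>i<?n. h i) + h ?n"
    by (metis add.commute sum.lessThan_Suc sum.lessThan_Suc_shift)
  then have shift: "(\<Sum>i<?n. h (Suc i)) = (\<Sum>i<?n. h i)"
    by (simp add: per)
  have "cyclic_eval z (ducci xs) = (\<Sum>i<?n. h i + z * h (Suc i))"
    unfolding cyclic_eval_def length_ducci h_def
    by (intro sum.cong refl)
       (simp add: cyc_ducci[OF \<open>xs \<noteq> []\<close>] of_int_abs_diff_char2[OF char2] algebra_simps z0)
  also have "\<dots> = (1 + z) * (\<Sum>i<?n. h i)"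
    by (simp add: sum.distrib shift algebra_simps flip: sum_distrib_left)
  finally show ?thesis by (simp add: cyclic_eval_def h_def)
qed

text \<open>In characteristic two, \<open>z \<noteq> 1\<close> makes \<open>1 + z\<close> nonzero, so the preperiod can be cancelled from
  the equation between powers of \<open>1 + z\<close>.\<close>

lemma unit_tuple_period:
  fixes z :: "'a::field"
  assumes char2: "(2::'a) = 0" and n: "n > 0" and z: "z ^ n = 1" "z \<noteq> 1"
    and p: "eventual_period_of (\<lambda>k. (ducci ^^ k) (1 # replicate (n - 1) 0)) p"
  shows "(1 + z) ^ p = 1"
proof -
  let ?e = "1 # replicate (n - 1) (0::int)"
  have len: "length ?e = n" using n by simp
  have e: "cyclic_eval z ?e = 1"
    using n by (cases n) (simp_all add: cyclic_eval_def cyc_def sum.lessThan_Suc_shift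
        del: sum.lessThan_Suc)
  have iter: "cyclic_eval z ((ducci ^^ k) ?e) = (1 + z) ^ k" for k
  proof (induction k)
    case (Suc k)
    have "length ((ducci ^^ k) ?e) = n" using len by simp
    moreover from this have "(ducci ^^ k) ?e \<noteq> []" using n by (metis list.size(3) less_numeral_extra(3))
    ultimately show ?case
      using Suc cyclic_eval_ducci[OF char2, of "(ducci ^^ k) ?e" z] z by simp
  qed (use e in simp)
  obtain N where "(ducci ^^ (N + p)) ?e = (ducci ^^ N) ?e"
    using p unfolding eventual_period_of_def by blast
  then have "(1 + z) ^ (N + p) = (1 + z) ^ N" by (metis iter)
  moreover have "1 + z \<noteq> 0"
    using z(2) char2 by (metis add_left_cancel one_add_one)
  ultimately show ?thesis by (simp add: power_add)
qed

section \<open>Roots of unity\<close>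

text \<open>The polynomial \<open>1 + X + \<dots>\<close> with \<open>m\<close> terms has a root, and 1 is not one, since its value at
  1 is \<open>m \<noteq> 0\<close>.\<close>

lemma nontrivial_root_of_unity:
  assumes "of_nat m \<noteq> (0 :: 'a::alg_closed_field)" and "m > 1"
  shows "\<exists>x::'a. x ^ m = 1 \<and> x \<noteq> 1"
proof -
  define q :: "'a poly" where "q = Poly (replicate m 1)"
  have "Polynomial.coeff q 1 \<noteq> 0"
    unfolding q_def using assms(2) by (simp add: coeff_Poly_eq nth_default_def)
  then have "Polynomial.degree q > 0"
    using le_degree[of q 1] by simp
  then obtain x where x: "poly q x = 0"
    using alg_closed_imp_poly_has_root by blast
  have poly_q: "poly q y = (\<Sum>i<m. y ^ i)" for y
    unfolding q_def
    by (induction m) (simp_all add: sum.lessThan_Suc_shift sum_distrib_left del: sum.lessThan_Suc)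
  have "x \<noteq> 1" using x assms(1) by (auto simp: poly_q)
  moreover have "x ^ m - 1 = 0"
    using x by (simp add: power_diff_1_eq poly_q)
  ultimately show ?thesis by auto
qed

text \<open>By induction on the prime factorization. To multiply the order by a prime \<open>p\<close>, a \<open>p\<close>-th root of
  the given element works if \<open>p\<close> already divides its order; otherwise one multiplies by a
  nontrivial \<open>p\<close>-th root of unity, whose order is coprime to that of the given element.\<close>

lemma primitive_root_of_unity:
  assumes "of_nat n \<noteq> (0 :: 'a::alg_closed_field)"
  shows "\<exists>w::'a. \<forall>k. w ^ k = 1 \<longleftrightarrow> n dvd k"
  using assms
proof (induction n rule: prime_divisors_induct)
  case (factor p n)
  then have p: "Factorial_Ring.prime p" and p0: "of_nat p \<noteq> (0::'a)" and n0: "of_nat n \<noteq> (0::'a)"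
    by auto
  obtain w :: 'a where w: "\<And>k. w ^ k = 1 \<longleftrightarrow> n dvd k"
    using factor.IH[OF n0] by blast
  show ?case
  proof (cases "p dvd n")
    case True
    obtain v where v: "v ^ p = w"
      using nth_root_exists prime_gt_0_nat[OF p] by blast
    have "v ^ k = 1 \<longleftrightarrow> p * n dvd k" for k
    proof
      assume "v ^ k = 1"
      then have "w ^ k = 1" using v by (metis mult.commute power_mult power_one)
      then have "p dvd k" using True w dvd_trans by blast
      then obtain l where l: "k = p * l" ..
      have "w ^ l = 1" using \<open>v ^ k = 1\<close> v l by (simp add: power_mult)
      then show "p * n dvd k" using l w by simp
    next
      assume "p * n dvd k"
      then obtain l where "k = p * (n * l)" by (auto simp: dvd_def mult.assoc)
      then show "v ^ k = 1" using v w[of "n * l"] by (simp add: power_mult)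
    qed
    then show ?thesis by blast
  next
    case False
    then have cop: "coprime p n" using p by (simp add: prime_imp_coprime)
    obtain z :: 'a where z: "z ^ p = 1" "z \<noteq> 1"
      using nontrivial_root_of_unity[OF p0] prime_gt_1_nat[OF p] by blast
    have z_dvd: "p dvd k" if "z ^ k = 1" for k
    proof (rule ccontr)
      assume "\<not> p dvd k"
      then have "coprime k p" using p prime_imp_coprime coprime_commute by blast
      then obtain x y where "k * x = p * y + 1"
        using coprime_bezout_strong[of k p] prime_gt_1_nat[OF p] by auto
      then have "z ^ (k * x) = z ^ (p * y + 1)" by simp
      then show False using that z by (simp add: power_mult power_add)
    qed
    have "(w * z) ^ k = 1 \<longleftrightarrow> p * n dvd k" for k
    proof
      assume wz: "(w * z) ^ k = 1"
      then have "(w * z) ^ (k * p) = 1" by (simp add: power_mult)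
      moreover have "(w * z) ^ (k * p) = w ^ (k * p) * (z ^ p) ^ k"
        by (simp add: power_mult_distrib mult.commute flip: power_mult)
      ultimately have "n dvd k * p" using w z by simp
      then have "n dvd k"
        using cop by (simp add: coprime_dvd_mult_left_iff coprime_commute)
      then have "w ^ k = 1" using w by simp
      then have "p dvd k" using wz by (intro z_dvd) (simp add: power_mult_distrib)
      then show "p * n dvd k" using \<open>n dvd k\<close> cop by (simp add: divides_mult)
    next
      assume "p * n dvd k"
      then have "n dvd k" "p dvd k" by (auto dest: dvd_mult_left dvd_mult_right)
      moreover from \<open>p dvd k\<close> have "z ^ k = 1"
        using z(1) by (auto simp: power_mult)
      ultimately show "(w * z) ^ k = 1"
        using w by (simp add: power_mult_distrib)
    qed
    then show ?thesis by blast
  qed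
qed (auto intro: exI[of _ 1])

section \<open>Products over sets of exponents\<close>

lemma frobenius_char2:
  assumes "(2::'a::comm_semiring_1) = 0"
  shows "(x + y :: 'a) ^ (2 ^ e) = x ^ (2 ^ e) + y ^ (2 ^ e)"
proof (induction e)
  case (Suc e)
  have "(u + v)\<^sup>2 = u\<^sup>2 + v\<^sup>2" for u v :: 'a
    using assms by (simp add: power2_sum)
  then show ?case using Suc by (simp add: power_mult mult.commute[of 2])
qed simp

text \<open>The first assumption on \<open>f\<close> is what Frobenius gives for coefficients in the prime field
  \<open>\<bbbF>\<^sub>2\<close>; in this form it is immediate for products and differences. It carries the root \<open>w\<close> to
  its conjugates under repeated squaring, and since \<open>w\<close> has order \<open>n\<close> the first \<open>ord n 2\<close> of
  these are distinct.\<close>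

lemma order_two_le_degree:
  fixes w :: "'a::field" and f :: "'a poly"
  assumes w: "\<And>k. w ^ k = 1 \<longleftrightarrow> n dvd k" and "odd n"
    and f: "\<And>x. poly f (x\<^sup>2) = (poly f x)\<^sup>2" "poly f w = 0" "f \<noteq> 0"
  shows "ord n 2 \<le> Polynomial.degree f"
proof -
  have root: "poly f (w ^ (2 ^ i)) = 0" for i
  proof (induction i)
    case (Suc i)
    have "w ^ 2 ^ Suc i = (w ^ (2 ^ i))\<^sup>2" by (simp add: power_mult mult.commute[of 2])
    then show ?case using Suc f(1) by simp
  qed (use f in simp)
  have w0: "w \<noteq> 0" using w[of n] \<open>odd n\<close> by (metis dvd_refl even_zero power_0_left zero_neq_one)
  have inj: "i = j" if "i \<le> j" "j < ord n 2" "w ^ (2 ^ i) = w ^ (2 ^ j)" for i j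
  proof -
    have le: "(2::nat) ^ i \<le> 2 ^ j" using that(1) by simp
    then have "w ^ (2 ^ j) = w ^ (2 ^ i) * w ^ (2 ^ j - 2 ^ i)"
      by (simp flip: power_add)
    then have "w ^ (2 ^ j - 2 ^ i) = 1" using that(3) w0 by simp
    then have "n dvd 2 ^ j - 2 ^ i" using w by simp
    also have "2 ^ j - 2 ^ i = 2 ^ i * (2 ^ (j - i) - (1::nat))"
      using that(1) by (simp add: diff_mult_distrib2 flip: power_add)
    finally have "n dvd 2 ^ (j - i) - 1"
      using \<open>odd n\<close> by (simp add: coprime_dvd_mult_right_iff)
    then obtain l where "2 ^ (j - i) - 1 = n * l" ..
    moreover have "(1::nat) \<le> 2 ^ (j - i)" by simp
    ultimately have "2 ^ (j - i) = 1 + n * l" by linarith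
    then have "[2 ^ (j - i) = 1] (mod n)"
      by (simp only: cong_def mod_mult_self2)
    then show "i = j" using that(1,2) ord_minimal[of "j - i" n 2] by linarith
  qed
  have "inj_on (\<lambda>i. w ^ (2 ^ i)) {..<ord n 2}"
    by (rule inj_onI) (metis inj lessThan_iff linorder_le_cases)
  then have "ord n 2 = card ((\<lambda>i. w ^ (2 ^ i)) ` {..<ord n 2})"
    by (simp add: card_image)
  also have "\<dots> \<le> card {x. poly f x = 0}"
    using root f(3) by (intro card_mono poly_roots_finite) auto
  also have "\<dots> \<le> Polynomial.degree f"
    by (rule card_poly_roots_bound[OF f(3)])
  finally show ?thesis .
qed

definition partition_poly :: "nat set \<Rightarrow> 'a::comm_ring_1 poly" where
  "partition_poly U = (\<Prod>j\<in>U. 1 + [:0, 1:] ^ j)"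

lemma poly_partition_poly:
  "poly (partition_poly U) x = (\<Prod>j\<in>U. 1 + x ^ j)"
  by (simp add: partition_poly_def poly_prod poly_power)

lemma degree_partition_poly_le:
  "Polynomial.degree (partition_poly U :: 'a::idom poly) \<le> \<Sum>U"
proof (cases "finite U")
  case True
  then have "Polynomial.degree (partition_poly U :: 'a poly) \<le>
      (\<Sum>j\<in>U. Polynomial.degree (1 + [:0, 1:] ^ j :: 'a poly))"
    unfolding partition_poly_def by (rule degree_prod_sum_le[unfolded o_def])
  also have "\<dots> \<le> \<Sum>U"
    by (intro sum_mono degree_add_le) (simp_all add: degree_power_eq)
  finally show ?thesis .
qed (simp add: partition_poly_def)

lemma partition_poly_cong_1:
  assumes "finite U" and "\<And>j. j \<in> U \<Longrightarrow> m \<le> j"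
  shows "([:0, 1:] ^ m :: 'a::comm_ring_1 poly) dvd partition_poly U - 1"
  using assms
proof (induction U)
  case (insert j U)
  let ?q = "partition_poly U :: 'a poly"
  have eq: "partition_poly (insert j U) - 1 = (?q - 1) + [:0, 1:] ^ j * ?q"
    using insert by (simp add: partition_poly_def algebra_simps)
  have "([:0, 1:] ^ m :: 'a poly) dvd [:0, 1:] ^ j"
    using insert by (simp add: le_imp_power_dvd)
  moreover have "([:0, 1:] ^ m :: 'a poly) dvd ?q - 1"
    using insert by simp
  ultimately show ?case unfolding eq by (intro dvd_add dvd_mult2)
qed (simp add: partition_poly_def)

text \<open>Modulo \<open>X\<close> to the power \<open>m + 1\<close> the left side is \<open>1 + X\<^sup>m\<close> and the right side is 1, as all
  other exponents in \<open>A\<close> and \<open>B\<close> exceed \<open>m\<close>.\<close>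

lemma partition_poly_disjoint_neq:
  assumes "finite A" "finite B" "m \<in> A" "m \<notin> B" and min: "\<And>j. j \<in> A \<union> B \<Longrightarrow> m \<le> j"
  shows "partition_poly A \<noteq> (partition_poly B :: 'a::idom poly)"
proof
  let ?X = "[:0, 1:] :: 'a poly"
  assume eq: "partition_poly A = (partition_poly B :: 'a poly)"
  have *: "?X ^ Suc m dvd partition_poly (A - {m}) - 1" "?X ^ Suc m dvd partition_poly B - 1"
    using assms by (intro partition_poly_cong_1; force simp: Suc_le_eq order_less_le)+
  have A: "partition_poly A = (1 + ?X ^ m) * partition_poly (A - {m})"
    unfolding partition_poly_def using assms by (simp add: prod.remove)
  have "?X ^ m = (partition_poly B - 1) - (1 + ?X ^ m) * (partition_poly (A - {m}) - 1)"
    using A eq by (simp add: algebra_simps)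
  then have "?X ^ Suc m dvd ?X ^ m"
    using * by (metis dvd_diff dvd_mult)
  then have "Suc m \<le> m"
    by (metis degree_linear_power dvd_imp_degree_le one_neq_zero pCons_eq_0_iff power_not_zero)
  then show False by simp
qed

text \<open>Cancelling the factors common to both products reduces the claim to disjoint sets. The
  exponent 0 is excluded because its factor is 2, which vanishes in characteristic two and would
  make the cancellation impossible.\<close>

lemma partition_poly_inj:
  assumes "finite U" "finite V" "0 \<notin> U" "0 \<notin> V"
    and eq: "partition_poly U = (partition_poly V :: 'a::idom poly)"
  shows "U = V"
proof (rule ccontr)
  assume "U \<noteq> V"
  let ?P = "partition_poly :: nat set \<Rightarrow> 'a poly"
  define A B where "A = U - V" and "B = V - U"
  have nz: "?P (U \<inter> V) \<noteq> 0"
  proof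
    assume "?P (U \<inter> V) = 0"
    then have "poly (?P (U \<inter> V)) 0 = 0" by simp
    moreover have "poly (?P (U \<inter> V)) 0 = 1"
      unfolding poly_partition_poly
      by (rule prod.neutral) (use assms in \<open>auto simp: power_0_left intro!: Nat.gr0I\<close>)
    ultimately show False by simp
  qed
  have "?P U = ?P (U \<inter> V) * ?P A" "?P V = ?P (U \<inter> V) * ?P B"
    unfolding partition_poly_def A_def B_def
    using assms by (simp_all add: prod.Int_Diff[of U _ V] prod.Int_Diff[of V _ U] Int_commute)
  then have PAB: "?P A = ?P B" using eq nz by simp
  have fin: "finite A" "finite B" and disj: "A \<inter> B = {}" and ne: "A \<union> B \<noteq> {}"
    using assms \<open>U \<noteq> V\<close> by (auto simp: A_def B_def)
  define m where "m = Min (A \<union> B)"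
  have "m \<in> A \<union> B" and min: "\<And>j. j \<in> A \<union> B \<Longrightarrow> m \<le> j"
    unfolding m_def using fin ne by (simp_all add: Min_in del: Un_iff)
  then consider "m \<in> A" "m \<notin> B" | "m \<in> B" "m \<notin> A" using disj by blast
  then show False
  proof cases
    case 1
    then show False using partition_poly_disjoint_neq[OF fin 1] min PAB by blast
  next
    case 2
    then show False using partition_poly_disjoint_neq[OF fin(2,1) 2] min PAB by (metis Un_commute)
  qed
qed

section \<open>The lower bound\<close>

lemma finite_coset_reps: "finite (coset_reps a n)"
  by (rule finite_subset[of _ "{..n}"]) (auto simp: coset_reps_def)

text \<open>The map from \<open>U\<close> to \<open>\<Prod>j\<in>U. 1 + w\<^sup>j\<close> sends these sets injectively to powers of \<open>1 + w\<^sup>a\<close>,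
  and there are at most \<open>p\<close> such powers. The bound on \<open>\<Sum>U\<close> keeps the degree of a difference of two
  partition polynomials below \<open>ord n 2\<close>, so that such a difference cannot vanish at \<open>w\<close> unless it
  is zero.\<close>

lemma card_bounded_sum_subsets_le_exponent:
  fixes w :: "'a::field"
  assumes char2: "(2::'a) = 0" and w: "\<And>k. w ^ k = 1 \<longleftrightarrow> n dvd k" and "odd n"
    and p: "p > 0" "(1 + w ^ a) ^ p = 1"
  shows "card {U. U \<subseteq> coset_reps a n \<and> \<Sum>U \<le> ord n 2 - 1} \<le> p"
proof -
  define y where "y = 1 + w ^ a"
  let ?C = "{U. U \<subseteq> coset_reps a n \<and> \<Sum>U \<le> ord n 2 - 1}"
  let ?P = "partition_poly :: nat set \<Rightarrow> 'a poly"
  have powers: "y ^ k \<in> (\<lambda>i. y ^ i) ` {..<p}" for k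
  proof -
    have "y ^ k = y ^ (p * (k div p) + k mod p)" by simp
    also have "\<dots> = y ^ (k mod p)"
      using p(2) unfolding power_add power_mult y_def by simp
    finally show ?thesis using p(1) by (intro image_eqI[of _ _ "k mod p"]) auto
  qed
  have wn: "w ^ n = 1" using w by simp
  have factor_power: "\<exists>e. 1 + w ^ j = y ^ (2 ^ e)" if j: "j \<in> coset_reps a n" for j
  proof -
    obtain e where "[j = a * 2 ^ e] (mod n)" using j by (auto simp: coset_reps_def)
    then have mod: "j mod n = (a * 2 ^ e) mod n" by (simp add: cong_def)
    have red: "w ^ k = w ^ (k mod n)" for k
      using wn by (metis div_mult_mod_eq mult.commute mult_1 power_add power_mult power_one)
    have "w ^ j = (w ^ a) ^ (2 ^ e)"
      using red[of j] red[of "a * 2 ^ e"] mod by (simp add: power_mult)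
    then show ?thesis
      unfolding y_def frobenius_char2[OF char2] by auto
  qed
  have value_power: "poly (?P U) w \<in> (\<lambda>i. y ^ i) ` {..<p}" if U: "U \<in> ?C" for U
  proof -
    obtain e where "\<And>j. j \<in> U \<Longrightarrow> 1 + w ^ j = y ^ (2 ^ e j)"
      using factor_power U by (metis (mono_tags, lifting) mem_Collect_eq subsetD)
    then have "poly (?P U) w = y ^ (\<Sum>j\<in>U. 2 ^ e j)"
      by (simp add: poly_partition_poly power_sum)
    then show ?thesis using powers by simp
  qed
  have finU: "finite U" if "U \<in> ?C" for U
    using that finite_coset_reps finite_subset by blast
  have tpos: "ord n 2 > 0" using \<open>odd n\<close> by simp
  have "inj_on (\<lambda>U. poly (?P U) w) ?C"
  proof (rule inj_onI)
    fix U V assume UV: "U \<in> ?C" "V \<in> ?C" and eq: "poly (?P U) w = poly (?P V) w"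
    have sq: "poly (?P W) (x\<^sup>2) = (poly (?P W) x)\<^sup>2" for W x
      using frobenius_char2[OF char2, of 1 _ 1]
      by (simp add: poly_partition_poly prod_power_distrib flip: power_mult)
         (simp add: mult.commute)
    have "?P U - ?P V = 0"
    proof (rule ccontr)
      assume nz: "?P U - ?P V \<noteq> 0"
      have "ord n 2 \<le> Polynomial.degree (?P U - ?P V)"
      proof (rule order_two_le_degree[OF w \<open>odd n\<close> _ _ nz])
        show "poly (?P U - ?P V) (x\<^sup>2) = (poly (?P U - ?P V) x)\<^sup>2" for x
          using frobenius_char2[OF char2, of _ _ 1] by (simp add: sq diff_eq_add_char2[OF char2])
      qed (simp add: eq)
      also have "\<dots> \<le> ord n 2 - 1"
        using UV degree_partition_poly_le[of U, where ?'a = 'a]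
          degree_partition_poly_le[of V, where ?'a = 'a]
        by (intro degree_diff_le) auto
      finally show False using tpos by linarith
    qed
    moreover have "0 \<notin> coset_reps a n" by (simp add: coset_reps_def)
    then have "0 \<notin> U" "0 \<notin> V" using UV by auto
    ultimately show "U = V"
      using partition_poly_inj[OF finU[OF UV(1)] finU[OF UV(2)], where ?'a = 'a] by simp
  qed
  then have "card ?C \<le> card ((\<lambda>i. y ^ i) ` {..<p})"
    by (rule card_inj_on_le) (use value_power in auto)
  also have "\<dots> \<le> p" using card_image_le[of "{..<p}"] by simp
  finally show ?thesis .
qed

lemma card_distinct_partitions_le:
  "card (distinct_partitions a n) \<le> card {U. U \<subseteq> coset_reps a n \<and> \<Sum>U \<le> ord n 2 - 1}"
proof (rule card_inj_on_le[of "\<lambda>u. {j \<in> coset_reps a n. u j = 1}"])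
  let ?S = "coset_reps a n"
  show "inj_on (\<lambda>u. {j \<in> ?S. u j = 1}) (distinct_partitions a n)"
  proof (rule inj_onI)
    fix u v assume uv: "u \<in> distinct_partitions a n" "v \<in> distinct_partitions a n"
      and eq: "{j \<in> ?S. u j = 1} = {j \<in> ?S. v j = 1}"
    show "u = v"
    proof (rule PiE_ext[of _ ?S "\<lambda>_. {0, 1}"])
      fix j assume "j \<in> ?S"
      then have "u j \<in> {0, 1}" "v j \<in> {0, 1}" "u j = 1 \<longleftrightarrow> v j = 1"
        using uv eq by (auto simp: distinct_partitions_def)
      then show "u j = v j" by auto
    qed (use uv in \<open>auto simp: distinct_partitions_def\<close>)
  qed
  show "(\<lambda>u. {j \<in> ?S. u j = 1}) ` distinct_partitions a n \<subseteq> {U. U \<subseteq> ?S \<and> \<Sum>U \<le> ord n 2 - 1}"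
  proof safe
    fix u assume u: "u \<in> distinct_partitions a n"
    have "\<Sum>{j \<in> ?S. u j = 1} = (\<Sum>j\<in>?S. if u j = 1 then j else 0)"
      using finite_coset_reps by (simp add: sum.If_cases Int_def)
    also have "\<dots> = (\<Sum>j\<in>?S. u j * j)"
      by (rule sum.cong) (use u in \<open>auto simp: distinct_partitions_def PiE_iff\<close>)
    finally show "\<Sum>{j \<in> ?S. u j = 1} \<le> ord n 2 - 1"
      using u by (simp add: distinct_partitions_def)
  qed
  show "finite {U. U \<subseteq> ?S \<and> \<Sum>U \<le> ord n 2 - 1}"
    using finite_coset_reps by simp
qed

theorem theorem2p1:
  fixes n a :: nat
  assumes "0 < n" and "odd n"
    and "1 \<le> a" and "a < n" and "coprime a n"
  shows "ducci_max_period n \<ge> card (distinct_partitions a n)"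
proof -
  have char2: "(2 :: bit alg_closure) = 0"
    by (metis bit_2_eq_0 to_ac_0 to_ac_numeral)
  have "of_nat n \<noteq> (0 :: bit alg_closure)"
    using \<open>odd n\<close> char2 by (auto elim!: oddE)
  then obtain w :: "bit alg_closure" where w: "\<And>k. w ^ k = 1 \<longleftrightarrow> n dvd k"
    using primitive_root_of_unity by blast
  have z: "(w ^ a) ^ n = 1" "w ^ a \<noteq> 1"
    using w assms by (auto simp flip: power_mult dest: dvd_imp_le)
  let ?e = "1 # replicate (n - 1) (0::int)"
  let ?p = "eventual_period (\<lambda>k. (ducci ^^ k) ?e)"
  have p: "eventual_period_of (\<lambda>k. (ducci ^^ k) ?e) ?p"
    by (rule ducci_eventual_period) simp
  then have "?p > 0" by (simp add: eventual_period_of_def)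
  have "card (distinct_partitions a n) \<le> ?p"
    using card_distinct_partitions_le
      card_bounded_sum_subsets_le_exponent[OF char2 w \<open>odd n\<close> \<open>?p > 0\<close>
        unit_tuple_period[OF char2 \<open>0 < n\<close> z p]]
    by (rule order_trans)
  also have "\<dots> \<le> ducci_max_period n"
    by (rule eventual_period_le_ducci_max_period) (use \<open>0 < n\<close> in simp_all)
  finally show ?thesis .
qed

end
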